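(* There exist a convex body $K\subseteq\mathbb{R}^3$ and a countable family $\mathcal{F}$ of translates of $K$ such that $\operatorname{vcdim}(\mathcal{F}^\ast)=\infty$.
   Context: A convex body in $\mathbb{R}^n$ is a compact convex set with non-empty interior. A translate of $K$ is a set $K+x$ with $x\in\mathbb{R}^3$. A set system $\mathcal{G}$ shatters a set $X$ if for every subset $X'\subseteq X$ there exists $G\in\mathcal{G}$ with $X\cap G=X'$. The VC-dimension of $\mathcal{G}$ is $\operatorname{vcdim}(\mathcal{G})=\sup\{\operatorname{card}(X) : \mathcal{G}\text{ shatters }X\}$, which is $\infty$ if there is no upper bound on the sizes of sets shattered by $\mathcal{G}$. For a family $\mathcal{F}$ of subsets of $\mathbb{R}^3$, the dual set system $\mathcal{F}^\ast$ is the set system on the ground set $\mathcal{F}$ consisting of the sets $\{F\in\mathcal{F} : x\in F\}$ for $x\in\mathbb{R}^3$. Thus $\operatorname{vcdim}(\mathcal{F}^\ast)$ (the dual VC-dimension of $\mathcal{F}$) is the supremum of the integers $m$ for which there are $m$ distinct members $F_1,\dots,F_m\in\mathcal{F}$ such that for every $I\subseteq\{1,\dots,m\}$ there is a point $x\in\mathbb{R}^3$ with $x\in F_i$ if and only if $i\in I$. *)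

theory Defs
  imports "HOL-Analysis.Analysis" "HOL-Library.Extended_Nat"
begin

definition convex_body :: "'a::euclidean_space set \<Rightarrow> bool" where
  "convex_body K \<longleftrightarrow> compact K \<and> convex K \<and> interior K \<noteq> {}"

definition is_translate :: "'a::euclidean_space set \<Rightarrow> 'a set \<Rightarrow> bool" where
  "is_translate K L \<longleftrightarrow> (\<exists>x. L = (\<lambda>y. y + x) ` K)"

(* The ground set is left implicit: taking X' = X shows that a shattered set is
   contained in a member of the system, hence in the ground set. *)
definition shatters :: "'a set set \<Rightarrow> 'a set \<Rightarrow> bool" where
  "shatters \<G> X \<longleftrightarrow> (\<forall>X' \<subseteq> X. \<exists>G \<in> \<G>. X \<inter> G = X')"

(* The case distinction is needed because card X = 0 for infinite X. *)
definition vcdim :: "'a set set \<Rightarrow> enat" where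
  "vcdim \<G> = (SUP X \<in> {X. shatters \<G> X}. if finite X then enat (card X) else \<infinity>)"

definition dual_system :: "'a set set \<Rightarrow> 'a set set set" where
  "dual_system \<F> = range (\<lambda>x. {F \<in> \<F>. x \<in> F})"

end

theory Submission
  imports Defs
begin

text \<open>
  The idea is to realise an arbitrary incidence pattern between points and translates on the
  paraboloid \<open>z = x\<^sup>2 + y\<^sup>2\<close>.  It is the sum of a curve in the \<open>xz\<close>-plane and a curve
  in the \<open>yz\<close>-plane: its point over \<open>(a, b)\<close> is \<open>p - x\<close> with \<open>p = (0, b, b\<^sup>2)\<close> and
  \<open>x = (- a, 0, - a\<^sup>2)\<close>.  Hence \<open>p\<close> lies in the translate \<open>K + x\<close> if and only if \<open>K\<close> contains
  the point of the paraboloid over \<open>(a, b)\<close>.  The paraboloid is strictly convex, so any of its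
  points can be cut off from the solid paraboloid by a plane parallel to the tangent plane, and
  the cut removes only a small neighbourhood of that point.

  Consequently, take the grid of all \<open>(2\<^sup>-\<^sup>i, 2\<^sup>-\<^sup>n)\<close>, all of whose points are isolated, enumerate
  the finite sets of naturals as \<open>I\<^sub>0, I\<^sub>1, \<dots>\<close>, and cut off the point over \<open>(2\<^sup>-\<^sup>i, 2\<^sup>-\<^sup>n)\<close>
  precisely if \<open>i \<notin> I\<^sub>n\<close>, so shallowly that all other grid points survive
  (\<open>cut_depth_le_dist\<close>).  The result is a convex body (\<open>convex_body_carved_paraboloid\<close>) with a
  sequence of translates such that every finite subset of the natural numbers is the set of
  indices of the translates that contain a certain point.
\<close>

section \<open>Paraboloids with caps cut off\<close>

text \<open>
  For \<open>d = 0\<close> the inequalities say that a point lies above all tangent planes, which is the solid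
  paraboloid.  A positive value \<open>d a b\<close> raises the plane that touches at the point over
  \<open>(a, b)\<close>; on the paraboloid it thereby cuts off the points whose projection is at distance
  less than \<open>sqrt (d a b)\<close> from \<open>(a, b)\<close>.  The bound \<open>7\<close> on the height is
  any number that leaves enough room above the part of the paraboloid over the unit square.
\<close>
definition carved_paraboloid :: "(real \<Rightarrow> real \<Rightarrow> real) \<Rightarrow> (real ^ 3) set" where
  "carved_paraboloid d =
     {v. v $ 3 \<le> 7 \<and> (\<forall>a b. 2 * a * v $ 1 + 2 * b * v $ 2 - a\<^sup>2 - b\<^sup>2 + d a b \<le> v $ 3)}"

lemma carved_paraboloid_eq_Inter_halfspaces:
  "carved_paraboloid d =
     {v. axis 3 1 \<bullet> v \<le> 7} \<inter>
     (\<Inter>a b. {v. vector [2 * a, 2 * b, - 1] \<bullet> v \<le> a\<^sup>2 + b\<^sup>2 - d a b})"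
  by (auto simp: carved_paraboloid_def inner_vec_def sum_3 axis_def algebra_simps)

lemma tangent_plane_identity:
  fixes a b x y :: real
  shows "2 * a * x + 2 * b * y - a\<^sup>2 - b\<^sup>2 = x\<^sup>2 + y\<^sup>2 - ((x - a)\<^sup>2 + (y - b)\<^sup>2)"
  by (simp add: power2_diff)

lemma convex_body_carved_paraboloid:
  assumes d: "\<And>a b. 0 \<le> d a b" "\<And>a b. d a b \<le> 1"
  shows "convex_body (carved_paraboloid d)"
proof -
  have "closed (carved_paraboloid d)"
    unfolding carved_paraboloid_eq_Inter_halfspaces
    by (intro closed_Int closed_INT ballI closed_halfspace_le)
  moreover have "convex (carved_paraboloid d)"
    unfolding carved_paraboloid_eq_Inter_halfspaces
    by (intro convex_Int convex_INT convex_halfspace_le)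
  moreover have "carved_paraboloid d \<subseteq> cbox (vector [-7, -7, -7]) (vector [7, 7, 7])"
  proof
    fix v assume v: "v \<in> carved_paraboloid d"
    \<comment> \<open>The tangent plane at the point below \<open>v\<close> gives the inequality of the paraboloid.\<close>
    then have "2 * v $ 1 * v $ 1 + 2 * v $ 2 * v $ 2 - (v $ 1)\<^sup>2 - (v $ 2)\<^sup>2
                 + d (v $ 1) (v $ 2) \<le> v $ 3" and z: "v $ 3 \<le> 7"
      unfolding carved_paraboloid_def by blast+
    with d(1)[of "v $ 1" "v $ 2"] have le: "(v $ 1)\<^sup>2 + (v $ 2)\<^sup>2 \<le> v $ 3"
      by (simp add: power2_eq_square)
    have "(v $ 1)\<^sup>2 \<le> 49" and "(v $ 2)\<^sup>2 \<le> 49"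
      using le z zero_le_power2[of "v $ 1"] zero_le_power2[of "v $ 2"] by linarith+
    then have "\<bar>v $ 1\<bar> \<le> 7" "\<bar>v $ 2\<bar> \<le> 7"
      using abs_le_square_iff[of "v $ 1" 7] abs_le_square_iff[of "v $ 2" 7] by simp_all
    moreover have "0 \<le> v $ 3"
      using le zero_le_power2[of "v $ 1"] zero_le_power2[of "v $ 2"] by linarith
    ultimately show "v \<in> cbox (vector [-7, -7, -7]) (vector [7, 7, 7])"
      using z by (simp add: mem_box_cart forall_3 abs_le_iff)
  qed
  then have "bounded (carved_paraboloid d)"
    using bounded_cbox bounded_subset by blast
  \<comment> \<open>Over the square with \<open>\<bar>x\<bar>, \<bar>y\<bar> \<le> 1\<close> tangent planes have height at most \<open>2\<close>, hence the raised ones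
      at most \<open>3\<close>, so a unit ball around height \<open>5\<close> fits between them and the bound \<open>7\<close>.\<close>
  moreover have "ball (vector [0, 0, 5]) 1 \<subseteq> carved_paraboloid d"
  proof
    fix v :: "real ^ 3" assume "v \<in> ball (vector [0, 0, 5]) 1"
    then have "norm (v - vector [0, 0, 5]) < 1"
      by (simp add: dist_norm norm_minus_commute)
    then have "\<bar>(v - vector [0, 0, 5]) $ i\<bar> < 1" for i
      using component_le_norm_cart le_less_trans by blast
    from this[of 1] this[of 2] this[of 3]
    have xyz: "\<bar>v $ 1\<bar> < 1" "\<bar>v $ 2\<bar> < 1" "\<bar>v $ 3 - 5\<bar> < 1" by simp_all
    then have "(v $ 1)\<^sup>2 \<le> 1" "(v $ 2)\<^sup>2 \<le> 1"
      by (simp_all add: abs_square_le_1)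
    then have "2 * a * v $ 1 + 2 * b * v $ 2 - a\<^sup>2 - b\<^sup>2 + d a b \<le> v $ 3" for a b
      using d(2)[of a b] xyz(3) tangent_plane_identity[of a "v $ 1" b "v $ 2"]
        zero_le_power2[of "v $ 1 - a"] zero_le_power2[of "v $ 2 - b"] by linarith
    with xyz(3) show "v \<in> carved_paraboloid d"
      by (simp add: carved_paraboloid_def)
  qed
  then have "interior (carved_paraboloid d) \<noteq> {}"
    using mem_interior[of "vector [0, 0, 5]" "carved_paraboloid d"] zero_less_one by blast
  ultimately show ?thesis
    by (simp add: convex_body_def compact_eq_bounded_closed)
qed

lemma paraboloid_point_mem_carved_iff:
  assumes "x\<^sup>2 + y\<^sup>2 \<le> 7"
  shows "vector [x, y, x\<^sup>2 + y\<^sup>2] \<in> carved_paraboloid d \<longleftrightarrow>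
           (\<forall>a b. d a b \<le> (x - a)\<^sup>2 + (y - b)\<^sup>2)"
proof -
  have "2 * a * x + 2 * b * y - a\<^sup>2 - b\<^sup>2 + d a b \<le> x\<^sup>2 + y\<^sup>2 \<longleftrightarrow>
          d a b \<le> (x - a)\<^sup>2 + (y - b)\<^sup>2" for a b
    unfolding tangent_plane_identity by linarith
  with assms show ?thesis
    by (simp add: carved_paraboloid_def)
qed

section \<open>Cutting off a prescribed set of grid points\<close>

text \<open>
  The number \<open>2\<^sup>-\<^sup>i\<close> has distance at least \<open>2\<^sup>-\<^sup>i / 2\<close> from all other powers, so the distance
  from a grid point \<open>(a, b)\<close> to any other one is at least \<open>min a b / 2\<close>, and
  hence at least \<open>a * b / 2\<close>.
\<close>
definition cut_depth :: "(nat \<Rightarrow> nat \<Rightarrow> bool) \<Rightarrow> real \<Rightarrow> real \<Rightarrow> real" where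
  "cut_depth R a b =
     (if \<exists>i n. \<not> R i n \<and> a = (1/2) ^ i \<and> b = (1/2) ^ n then (a * b / 2)\<^sup>2 else 0)"

lemma half_power_gap:
  assumes "i \<noteq> j"
  shows "(1/2) ^ i / 2 \<le> \<bar>(1/2) ^ j - (1/2 :: real) ^ i\<bar>"
proof (cases "i < j")
  case True
  then have "(1/2 :: real) ^ j \<le> (1/2) ^ Suc i"
    by (intro power_decreasing) auto
  then have "(1/2 :: real) ^ j \<le> (1/2) ^ i / 2" by simp
  then show ?thesis by linarith
next
  case False
  with assms have "(1/2 :: real) ^ i \<le> (1/2) ^ Suc j"
    by (intro power_decreasing) auto
  then have "(1/2 :: real) ^ i \<le> (1/2) ^ j / 2" by simp
  then show ?thesis by linarith
qed

lemma cut_depth_bounds: "0 \<le> cut_depth R a b" "cut_depth R a b \<le> 1"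
proof -
  have "((1/2) ^ i * (1/2) ^ n / 2)\<^sup>2 \<le> (1::real)" for i n
    using power_le_one[of "1/2 :: real" "i + n"]
    by (intro power_le_one) (auto simp: power_add)
  then show "0 \<le> cut_depth R a b" "cut_depth R a b \<le> 1"
    by (auto simp: cut_depth_def)
qed

lemma cut_depth_le_dist:
  assumes "R j m"
  shows "cut_depth R a b \<le> ((1/2) ^ j - a)\<^sup>2 + ((1/2) ^ m - b)\<^sup>2"
proof (cases "\<exists>i n. \<not> R i n \<and> a = (1/2) ^ i \<and> b = (1/2) ^ n")
  case True
  then obtain i n where R: "\<not> R i n" and ab: "a = (1/2) ^ i" "b = (1/2) ^ n" by blast
  have pos: "0 < a" "0 < b" and le1: "a \<le> 1" "b \<le> 1"
    by (simp_all add: ab power_le_one)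
  have depth: "cut_depth R a b = (a * b / 2)\<^sup>2"
    using True by (simp only: cut_depth_def if_True)
  from R assms have "i \<noteq> j \<or> n \<noteq> m" by blast
  then show ?thesis
  proof
    assume "i \<noteq> j"
    have "a * b / 2 \<le> a / 2"
      using pos le1 by (simp add: mult_left_le)
    also have "\<dots> \<le> \<bar>(1/2) ^ j - a\<bar>"
      using half_power_gap[OF \<open>i \<noteq> j\<close>] by (simp add: ab)
    finally have "(a * b / 2)\<^sup>2 \<le> \<bar>(1/2) ^ j - a\<bar>\<^sup>2"
      using pos by (intro power_mono) auto
    with depth show ?thesis by (simp add: add_increasing2)
  next
    assume "n \<noteq> m"
    have "a * b / 2 \<le> b / 2"
      using pos le1 by (simp add: mult_left_le_one_le)
    also have "\<dots> \<le> \<bar>(1/2) ^ m - b\<bar>"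
      using half_power_gap[OF \<open>n \<noteq> m\<close>] by (simp add: ab)
    finally have "(a * b / 2)\<^sup>2 \<le> \<bar>(1/2) ^ m - b\<bar>\<^sup>2"
      using pos by (intro power_mono) auto
    with depth show ?thesis by (simp add: add_increasing)
  qed
next
  case False
  then have "cut_depth R a b = 0" by (simp only: cut_depth_def if_False)
  then show ?thesis by simp
qed

lemma grid_point_mem_carved_iff:
  defines "u \<equiv> \<lambda>i. (1/2 :: real) ^ i"
  shows "vector [u i, u n, (u i)\<^sup>2 + (u n)\<^sup>2] \<in> carved_paraboloid (cut_depth R) \<longleftrightarrow> R i n"
proof -
  have le1: "(u k)\<^sup>2 \<le> 1" for k
    by (simp add: u_def power_le_one)
  have "(\<forall>a b. cut_depth R a b \<le> (u i - a)\<^sup>2 + (u n - b)\<^sup>2) \<longleftrightarrow> R i n"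
  proof
    assume le: "\<forall>a b. cut_depth R a b \<le> (u i - a)\<^sup>2 + (u n - b)\<^sup>2"
    show "R i n"
    proof (rule ccontr)
      assume "\<not> R i n"
      then have "cut_depth R (u i) (u n) = (u i * u n / 2)\<^sup>2"
        unfolding cut_depth_def u_def by (intro if_P) blast
      moreover have "0 < (u i * u n / 2)\<^sup>2"
        by (simp add: u_def)
      ultimately show False using le[rule_format, of "u i" "u n"] by simp
    qed
  qed (simp add: u_def cut_depth_le_dist)
  moreover have "(u i)\<^sup>2 + (u n)\<^sup>2 \<le> 7"
    using le1[of i] le1[of n] by linarith
  ultimately show ?thesis
    by (simp only: paraboloid_point_mem_carved_iff)
qed

text \<open>
  A single convex body thus encodes an arbitrary binary relation on the natural numbers as the
  incidence relation between a sequence of its translates and a sequence of points.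
\<close>
lemma incidence_relation_of_translates:
  fixes R :: "nat \<Rightarrow> nat \<Rightarrow> bool"
  obtains K :: "(real ^ 3) set" and x p :: "nat \<Rightarrow> real ^ 3"
  where "convex_body K" and "\<And>i n. p n \<in> (\<lambda>y. y + x i) ` K \<longleftrightarrow> R i n"
proof -
  define u :: "nat \<Rightarrow> real" where "u = (\<lambda>i. (1/2) ^ i)"
  define K where "K = carved_paraboloid (cut_depth R)"
  define x :: "nat \<Rightarrow> real ^ 3" where "x = (\<lambda>i. vector [- u i, 0, - (u i)\<^sup>2])"
  define p :: "nat \<Rightarrow> real ^ 3" where "p = (\<lambda>n. vector [0, u n, (u n)\<^sup>2])"
  have "convex_body K"
    unfolding K_def by (intro convex_body_carved_paraboloid cut_depth_bounds)
  moreover have "p n \<in> (\<lambda>y. y + x i) ` K \<longleftrightarrow> R i n" for i n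
  proof -
    have "p n - x i = vector [u i, u n, (u i)\<^sup>2 + (u n)\<^sup>2]"
      by (simp add: p_def x_def vec_eq_iff forall_3)
    moreover have "p n \<in> (\<lambda>y. y + x i) ` K \<longleftrightarrow> p n - x i \<in> K"
      by (auto simp: image_iff intro: bexI[of _ "p n - x i"])
    ultimately show ?thesis
      unfolding K_def u_def by (simp only: grid_point_mem_carved_iff)
  qed
  ultimately show thesis
    by (rule that)
qed

section \<open>Infinite dual VC-dimension\<close>

lemma vcdim_eq_infinity:
  assumes "\<And>m. \<exists>X. shatters \<G> X \<and> finite X \<and> card X = m"
  shows "vcdim \<G> = \<infinity>"
proof -
  have "enat m \<le> vcdim \<G>" for m
  proof -
    obtain X where X: "shatters \<G> X" "finite X" "card X = m" using assms by metis
    have "(if finite X then enat (card X) else \<infinity>) \<le> vcdim \<G>"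
      unfolding vcdim_def by (rule SUP_upper) (simp add: X)
    then show ?thesis
      by (simp add: X)
  qed
  from this[of "Suc (the_enat (vcdim \<G>))"] show ?thesis
    by (cases "vcdim \<G>") simp_all
qed

text \<open>
  The indexing of the sets is automatically injective, because the indices are told apart by the
  points that lie in exactly one of the sets.  So shattering index sets of every finite size is
  the same as shattering families of every finite size.
\<close>
lemma vcdim_dual_system_eq_infinity:
  fixes F :: "nat \<Rightarrow> 'a set"
  assumes realize: "\<And>I. finite I \<Longrightarrow> \<exists>p. \<forall>i. p \<in> F i \<longleftrightarrow> i \<in> I"
  shows "vcdim (dual_system (range F)) = \<infinity>"
proof (rule vcdim_eq_infinity)
  fix m :: nat
  have "inj F"
  proof (rule injI)
    fix i j assume eq: "F i = F j"
    obtain p where p: "\<forall>k. p \<in> F k \<longleftrightarrow> k \<in> {i}"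
      using realize[of "{i}"] by auto
    then have "p \<in> F i" by blast
    then have "p \<in> F j" by (simp only: eq)
    with p show "i = j" by simp
  qed
  have "shatters (dual_system (range F)) (F ` {..<m})"
    unfolding shatters_def
  proof (intro allI impI)
    fix X' assume "X' \<subseteq> F ` {..<m}"
    then obtain I where I: "I \<subseteq> {..<m}" "X' = F ` I"
      by (auto elim: subset_imageE)
    obtain p where p: "\<forall>i. p \<in> F i \<longleftrightarrow> i \<in> I"
      using realize[OF finite_subset[OF I(1) finite_lessThan]] by metis
    have "F ` {..<m} \<inter> {S \<in> range F. p \<in> S} = X'"
      unfolding I(2) using p I(1) by auto
    moreover have "{S \<in> range F. p \<in> S} \<in> dual_system (range F)"
      unfolding dual_system_def by (rule rangeI)
    ultimately show "\<exists>G\<in>dual_system (range F). F ` {..<m} \<inter> G = X'"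
      by (rule bexI)
  qed
  moreover have "card (F ` {..<m}) = m"
    using card_image[OF inj_on_subset[OF \<open>inj F\<close> subset_UNIV]] by simp
  ultimately show "\<exists>X. shatters (dual_system (range F)) X \<and> finite X \<and> card X = m"
    by blast
qed

theorem corollary5:
  shows "\<exists>(K :: (real ^ 3) set) (\<F> :: (real ^ 3) set set).
           convex_body K \<and> countable \<F> \<and> (\<forall>F \<in> \<F>. is_translate K F) \<and>
           vcdim (dual_system \<F>) = \<infinity>"
proof -
  \<comment> \<open>The \<open>n\<close>-th point has to lie in the translates whose indices form the \<open>n\<close>-th finite set.\<close>
  obtain K :: "(real ^ 3) set" and x p :: "nat \<Rightarrow> real ^ 3" where K: "convex_body K"
    and inc: "\<And>i n. p n \<in> (\<lambda>y. y + x i) ` K \<longleftrightarrow> i \<in> set_decode n"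
    by (rule incidence_relation_of_translates[where R = "\<lambda>i n. i \<in> set_decode n"])
       (rule that)
  let ?F = "\<lambda>i. (\<lambda>y. y + x i) ` K"
  have "\<exists>q. \<forall>i. q \<in> ?F i \<longleftrightarrow> i \<in> I" if "finite I" for I
    using inc[of "set_encode I"] set_encode_inverse[OF that] by auto
  then have "vcdim (dual_system (range ?F)) = \<infinity>"
    by (rule vcdim_dual_system_eq_infinity)
  moreover have "\<forall>L \<in> range ?F. is_translate K L"
    by (auto simp: is_translate_def)
  ultimately show ?thesis
    using K by (intro exI[of _ K] exI[of _ "range ?F"]) simp
qed

end
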